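(* Let $\psi,\phi$ be symmetric nonnegative functions on pairs of positive integers, not depending on $N$, and let $\{CFP(N)\}_{N\ge1}$ be the sequence of mean-field coagulation-fragmentation processes (assumed ergodic) with rates of single coagulations $\psi(i,j)$ and rates of single fragmentations $\phi(i,j)$. Then the induced processes $|X_N(t)|$, $t\ge0$, of the total number of groups are time homogeneous birth and death processes for all $N\ge1$ if and only if $$\psi(i,j)=a(i+j)+b,\quad i,j\ge1,$$ for some constants $a,b$ with $a\ge0$, $2a+b\ge0$, and $$v_k:=\sum_{1\le i\le j:\ i+j=k}\phi(i,j)=\phi(1,1)(k-1),\quad k\ge1,$$ where $v_2=\phi(1,1)\ge0$ is arbitrary.
   Context: For $N\ge1$, $\Omega_N$ is the set of all partitions of $N$, i.e. vectors $\eta=(n_1,\dots,n_N)$ of nonnegative integers with $\sum_{i=1}^N i n_i=N$ ($n_i$ is the number of groups of size $i$). Write $|\eta|=\sum_i n_i$ and $\Omega_{N,r}=\{\eta\in\Omega_N:|\eta|=r\}$. For $\eta\in\Omega_N$, $\eta^{(i,j)}$ denotes the partition obtained from $\eta$ by merging a group of size $i$ and a group of size $j$ into one of size $i+j$; $\eta_{(i,j)}$ denotes the partition obtained by splitting a group of size $i+j$ into groups of sizes $i$ and $j$. Given symmetric nonnegative $\psi,\phi$ not depending on $N$, the mean-field $CFP(N)$ is the continuous-time, time homogeneous Markov chain on $\Omega_N$ with transition rates $$K(\eta\to\eta^{(i,j)})=n_in_j\psi(i,j)\ (i\ne j),\quad K(\eta\to\eta^{(i,i)})=\tfrac{n_i(n_i-1)}{2}\psi(i,i),\quad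 F(\eta\to\eta_{(i,j)})=n_{i+j}\phi(i,j),\quad 2\le i+j\le N.$$ $X_N^{(\rho)}(t)$ denotes this process with initial distribution $\rho$ on $\Omega_N$, and $|X_N^{(\rho)}(t)|$ is the total number of groups at time $t$. "Ergodic" means that the law of $X_N^{(\rho)}(t)$ converges as $t\to\infty$ to a limit not depending on $\rho$ (absorbing states are allowed). The birth and death rates of the induced process are $$\lambda_{r,N}(t;\rho)=\lim_{\Delta t\to0^+}\tfrac1{\Delta t}\mathbb{P}\big(|X_N^{(\rho)}(t+\Delta t)|=r+1\,\big|\,|X_N^{(\rho)}(t)|=r\big),\quad 1\le r\le N-1,$$ $$\mu_{r,N}(t;\rho)=\lim_{\Delta t\to0^+}\tfrac1{\Delta t}\mathbb{P}\big(|X_N^{(\rho)}(t+\Delta t)|=r-1\,\big|\,|X_N^{(\rho)}(t)|=r\big),\quad 2\le r\le N,$$ defined whenever $\mathbb{P}(|X_N^{(\rho)}(t)|=r)>0$. The process of the total number of groups is called time homogeneous (written $|X_N(t)|$) if these rates do not depend on $t\ge0$ nor on the initial distribution $\rho$ on $\Omega_N$. *)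

theory Defs
  imports "HOL-Probability.Probability"
begin

section \<open>Finite-state Markov chains in continuous time\<close>

text \<open>
  \<open>P t x\<close> is the law at time \<open>t\<close> of the chain started at \<open>x\<close>: a transition semigroup on the
  finite set \<open>S\<close> whose off-diagonal derivatives at \<open>0\<close> are the prescribed transition rates \<open>q\<close>.
  Since every \<open>P t x\<close> has total mass one, the diagonal derivatives are then determined as well;
  the values \<open>q x x\<close> play no role.
\<close>

definition transition_semigroup ::
  "'s set \<Rightarrow> ('s \<Rightarrow> 's \<Rightarrow> real) \<Rightarrow> (real \<Rightarrow> 's \<Rightarrow> 's pmf) \<Rightarrow> bool" where
  "transition_semigroup S q P \<longleftrightarrow>
     (\<forall>t\<ge>0. \<forall>x\<in>S. set_pmf (P t x) \<subseteq> S) \<and>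
     (\<forall>x\<in>S. P 0 x = return_pmf x) \<and>
     (\<forall>s\<ge>0. \<forall>t\<ge>0. \<forall>x\<in>S. P (s + t) x = bind_pmf (P s x) (P t)) \<and>
     (\<forall>x\<in>S. \<forall>y\<in>S. x \<noteq> y \<longrightarrow> ((\<lambda>h. pmf (P h x) y / h) \<longlongrightarrow> q x y) (at_right 0))"

text \<open>
  Only times \<open>t \<ge> 0\<close> are relevant. The last conjunct is the Markov property: given the values at
  the times \<open>\<tau> 0 \<le> \<dots> \<le> \<tau> n\<close>, the law at time \<open>\<tau> n + h\<close> depends on the last value only.
\<close>

definition markov_chain ::
  "'w measure \<Rightarrow> 's set \<Rightarrow> ('s \<Rightarrow> 's \<Rightarrow> real) \<Rightarrow> 's pmf \<Rightarrow> (real \<Rightarrow> 'w \<Rightarrow> 's) \<Rightarrow> bool" where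
  "markov_chain M S q \<rho> X \<longleftrightarrow>
     prob_space M \<and>
     (\<forall>t\<ge>0. X t \<in> measurable M (count_space S)) \<and>
     (\<forall>x\<in>S. \<P>(\<omega> in M. X 0 \<omega> = x) = pmf \<rho> x) \<and>
     (\<exists>P. transition_semigroup S q P \<and>
        (\<forall>(n::nat) (\<tau>::nat \<Rightarrow> real) x. \<forall>y\<in>S. \<forall>h\<ge>0.
           0 \<le> \<tau> 0 \<and> (\<forall>i<n. \<tau> i \<le> \<tau> (Suc i)) \<and>
           \<P>(\<omega> in M. \<forall>i\<le>n. X (\<tau> i) \<omega> = x i) > 0 \<longrightarrow>
           \<P>(\<omega> in M. X (\<tau> n + h) \<omega> = y \<bar> \<forall>i\<le>n. X (\<tau> i) \<omega> = x i) = pmf (P h (x n)) y))"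


section \<open>Mean-field coagulation-fragmentation processes\<close>

type_synonym state = "nat \<Rightarrow> nat"

definition partitions :: "nat \<Rightarrow> state set" where
  "partitions N = {\<eta>. (\<forall>i. i \<notin> {1..N} \<longrightarrow> \<eta> i = 0) \<and> (\<Sum>i=1..N. i * \<eta> i) = N}"

definition groups :: "nat \<Rightarrow> state \<Rightarrow> nat" where
  "groups N \<eta> = (\<Sum>i=1..N. \<eta> i)"

text \<open>
  For \<open>i, j \<ge> 1\<close>; truncated subtraction matters only if \<open>\<eta>\<close> lacks the groups to be merged or
  split, in which case the corresponding rate below is zero.
\<close>

definition merge :: "nat \<Rightarrow> nat \<Rightarrow> state \<Rightarrow> state" where
  "merge i j \<eta> = (\<lambda>k. \<eta> k + of_bool (k = i + j) - of_bool (k = i) - of_bool (k = j))"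

definition split :: "nat \<Rightarrow> nat \<Rightarrow> state \<Rightarrow> state" where
  "split i j \<eta> = (\<lambda>k. \<eta> k + of_bool (k = i) + of_bool (k = j) - of_bool (k = i + j))"

definition coagulation_rate :: "(nat \<Rightarrow> nat \<Rightarrow> real) \<Rightarrow> state \<Rightarrow> nat \<Rightarrow> nat \<Rightarrow> real" where
  "coagulation_rate \<psi> \<eta> i j =
     (if i = j then real (\<eta> i) * (real (\<eta> i) - 1) / 2 * \<psi> i i
      else real (\<eta> i) * real (\<eta> j) * \<psi> i j)"

definition fragmentation_rate :: "(nat \<Rightarrow> nat \<Rightarrow> real) \<Rightarrow> state \<Rightarrow> nat \<Rightarrow> nat \<Rightarrow> real" where
  "fragmentation_rate \<phi> \<eta> i j = real (\<eta> (i + j)) * \<phi> i j"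

text \<open>The unordered pairs of sizes \<open>i, j\<close> are represented by the pairs with \<open>i \<le> j\<close>.\<close>

definition size_pairs :: "nat \<Rightarrow> (nat \<times> nat) set" where
  "size_pairs N = {(i, j). 1 \<le> i \<and> i \<le> j \<and> i + j \<le> N}"

definition cfp_rate ::
  "nat \<Rightarrow> (nat \<Rightarrow> nat \<Rightarrow> real) \<Rightarrow> (nat \<Rightarrow> nat \<Rightarrow> real) \<Rightarrow> state \<Rightarrow> state \<Rightarrow> real" where
  "cfp_rate N \<psi> \<phi> \<eta> \<zeta> =
     (\<Sum>(i, j) \<in> size_pairs N.
        (if \<zeta> = merge i j \<eta> then coagulation_rate \<psi> \<eta> i j else 0) +
        (if \<zeta> = split i j \<eta> then fragmentation_rate \<phi> \<eta> i j else 0))"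

definition initial_laws :: "nat \<Rightarrow> state pmf set" where
  "initial_laws N = {\<rho>. set_pmf \<rho> \<subseteq> partitions N}"

text \<open>
  A realization of \<open>CFP(N)\<close> consists of one process \<open>X \<rho>\<close>, on a probability space \<open>M \<rho>\<close>, for each
  initial distribution \<open>\<rho>\<close>.
\<close>

definition is_CFP ::
  "nat \<Rightarrow> (nat \<Rightarrow> nat \<Rightarrow> real) \<Rightarrow> (nat \<Rightarrow> nat \<Rightarrow> real) \<Rightarrow>
   (state pmf \<Rightarrow> 'w measure) \<Rightarrow> (state pmf \<Rightarrow> real \<Rightarrow> 'w \<Rightarrow> state) \<Rightarrow> bool" where
  "is_CFP N \<psi> \<phi> M X \<longleftrightarrow>
     (\<forall>\<rho>\<in>initial_laws N. markov_chain (M \<rho>) (partitions N) (cfp_rate N \<psi> \<phi>) \<rho> (X \<rho>))"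

definition ergodic ::
  "nat \<Rightarrow> (state pmf \<Rightarrow> 'w measure) \<Rightarrow> (state pmf \<Rightarrow> real \<Rightarrow> 'w \<Rightarrow> state) \<Rightarrow> bool" where
  "ergodic N M X \<longleftrightarrow>
     (\<exists>\<pi>\<in>initial_laws N. \<forall>\<rho>\<in>initial_laws N. \<forall>\<eta>\<in>partitions N.
        ((\<lambda>t. \<P>(\<omega> in M \<rho>. X \<rho> t \<omega> = \<eta>)) \<longlongrightarrow> pmf \<pi> \<eta>) at_top)"


section \<open>The induced process of the total number of groups\<close>

definition has_rate ::
  "'w measure \<Rightarrow> (real \<Rightarrow> 'w \<Rightarrow> nat) \<Rightarrow> real \<Rightarrow> nat \<Rightarrow> nat set \<Rightarrow> real \<Rightarrow> bool" where
  "has_rate M Y t r A l \<longleftrightarrow>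
     ((\<lambda>h. \<P>(\<omega> in M. Y (t + h) \<omega> \<in> A \<bar> Y t \<omega> = r) / h) \<longlongrightarrow> l) (at_right 0)"

definition has_birth_rate ::
  "'w measure \<Rightarrow> (real \<Rightarrow> 'w \<Rightarrow> nat) \<Rightarrow> real \<Rightarrow> nat \<Rightarrow> real \<Rightarrow> bool" where
  "has_birth_rate M Y t r l \<longleftrightarrow> has_rate M Y t r {r + 1} l"

definition has_death_rate ::
  "'w measure \<Rightarrow> (real \<Rightarrow> 'w \<Rightarrow> nat) \<Rightarrow> real \<Rightarrow> nat \<Rightarrow> real \<Rightarrow> bool" where
  "has_death_rate M Y t r l \<longleftrightarrow> has_rate M Y t r {r - 1} l"

text \<open>
  The first conjunct says that jumps of size two or more have rate zero, the other two that the birth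
  and death rates exist and depend neither on the time nor on the initial distribution, wherever
  they are defined. The family \<open>Y\<close> is indexed by the initial distribution \<open>\<rho>\<close> of the underlying
  process.
\<close>

definition time_homogeneous_birth_death ::
  "nat \<Rightarrow> (state pmf \<Rightarrow> 'w measure) \<Rightarrow> (state pmf \<Rightarrow> real \<Rightarrow> 'w \<Rightarrow> nat) \<Rightarrow> bool" where
  "time_homogeneous_birth_death N M Y \<longleftrightarrow>
     (\<forall>r. \<forall>\<rho>\<in>initial_laws N. \<forall>t\<ge>0. \<P>(\<omega> in M \<rho>. Y \<rho> t \<omega> = r) > 0 \<longrightarrow>
        has_rate (M \<rho>) (Y \<rho>) t r (- {r - 1..r + 1}) 0) \<and>
     (\<forall>r. 1 \<le> r \<and> r + 1 \<le> N \<longrightarrow>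
        (\<exists>l. \<forall>\<rho>\<in>initial_laws N. \<forall>t\<ge>0. \<P>(\<omega> in M \<rho>. Y \<rho> t \<omega> = r) > 0 \<longrightarrow>
           has_birth_rate (M \<rho>) (Y \<rho>) t r l)) \<and>
     (\<forall>r. 2 \<le> r \<and> r \<le> N \<longrightarrow>
        (\<exists>m. \<forall>\<rho>\<in>initial_laws N. \<forall>t\<ge>0. \<P>(\<omega> in M \<rho>. Y \<rho> t \<omega> = r) > 0 \<longrightarrow>
           has_death_rate (M \<rho>) (Y \<rho>) t r m))"

definition total_fragmentation :: "(nat \<Rightarrow> nat \<Rightarrow> real) \<Rightarrow> nat \<Rightarrow> real" where
  "total_fragmentation \<phi> k = (\<Sum>(i, j) \<in> {(i, j). 1 \<le> i \<and> i \<le> j \<and> i + j = k}. \<phi> i j)"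

end

theory Submission
  imports Defs
begin

text \<open>
  The rates of the number of groups at time \<open>t\<close>, given that it equals \<open>r\<close>, are averages over the
  partitions with \<open>r\<close> groups of their total coagulation and total fragmentation rates, and a
  deterministic start puts all the weight on one partition. So time homogeneity means that these
  totals depend only on \<open>N\<close> and \<open>r\<close>. For two groups this makes \<open>\<psi> i j = g (i + j)\<close>, and comparing
  \<open>{1, 1, m}\<close> with \<open>{1, 2, m - 1}\<close> makes \<open>g\<close> affine; comparing \<open>{1, n + 1}\<close> with \<open>{2, n}\<close> makes the
  total fragmentation rates an arithmetic progression. Conversely, for an affine \<open>\<psi>\<close> the total
  coagulation rate is \<open>(r - 1) (2 a N + b r) / 2\<close>, and for \<open>v\<^sub>k = c (k - 1)\<close> the total fragmentation
  rate is \<open>c (N - r)\<close>.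
\<close>

section \<open>Rates of functions of a finite Markov chain\<close>

lemma markov_chain_sets:
  assumes "markov_chain M S q \<rho> X" and "0 \<le> t" and "x \<in> S"
  shows "{\<omega> \<in> space M. X t \<omega> = x} \<in> sets M"
proof -
  have "X t \<in> measurable M (count_space S)"
    using assms by (simp add: markov_chain_def)
  then have "X t -` {x} \<inter> space M \<in> sets M"
    using assms(3) by (intro measurable_sets) auto
  moreover have "{\<omega> \<in> space M. X t \<omega> = x} = X t -` {x} \<inter> space M"
    by auto
  ultimately show ?thesis
    by simp
qed

text \<open>The case \<open>n = 0\<close> of the Markov property, multiplied out. The product form
  also covers states of probability zero, where both sides vanish by monotonicity of the
  measure.\<close>

lemma markov_chain_joint_law:
  assumes "markov_chain M S q \<rho> X"
  shows "\<exists>P. transition_semigroup S q P \<and> (\<forall>t\<ge>0. \<forall>h\<ge>0. \<forall>x\<in>S. \<forall>y\<in>S.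
    \<P>(\<omega> in M. X t \<omega> = x \<and> X (t + h) \<omega> = y) = \<P>(\<omega> in M. X t \<omega> = x) * pmf (P h x) y)"
proof -
  interpret prob_space M
    using assms by (simp add: markov_chain_def)
  obtain P where P: "transition_semigroup S q P"
    and mk: "\<And>(n::nat) (\<tau>::nat \<Rightarrow> real) x y h. y \<in> S \<Longrightarrow> 0 \<le> h \<Longrightarrow>
          0 \<le> \<tau> 0 \<and> (\<forall>i<n. \<tau> i \<le> \<tau> (Suc i)) \<and>
           \<P>(\<omega> in M. \<forall>i\<le>n. X (\<tau> i) \<omega> = x i) > 0 \<Longrightarrow>
           \<P>(\<omega> in M. X (\<tau> n + h) \<omega> = y \<bar> \<forall>i\<le>n. X (\<tau> i) \<omega> = x i) = pmf (P h (x n)) y"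
    using assms unfolding markov_chain_def by blast
  have "\<P>(\<omega> in M. X t \<omega> = x \<and> X (t + h) \<omega> = y) = \<P>(\<omega> in M. X t \<omega> = x) * pmf (P h x) y"
    if "0 \<le> t" "0 \<le> h" "x \<in> S" "y \<in> S" for t h x y
  proof (cases "\<P>(\<omega> in M. X t \<omega> = x) > 0")
    case True
    then have "\<P>(\<omega> in M. X (t + h) \<omega> = y \<bar> X t \<omega> = x) = pmf (P h x) y"
      using mk[of y h "\<lambda>_. t" 0 "\<lambda>_. x"] that by simp
    with True show ?thesis
      by (simp add: cond_prob_def field_simps conj_commute)
  next
    case False
    have "{\<omega> \<in> space M. X t \<omega> = x} \<in> sets M"
      using markov_chain_sets[OF assms] that by simp
    then have "\<P>(\<omega> in M. X t \<omega> = x \<and> X (t + h) \<omega> = y) \<le> \<P>(\<omega> in M. X t \<omega> = x)"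
      by (intro finite_measure_mono) auto
    moreover have "\<P>(\<omega> in M. X t \<omega> = x) = 0"
      using False measure_nonneg by (metis not_less order_antisym)
    ultimately show ?thesis
      by (metis measure_nonneg mult_zero_left order_antisym)
  qed
  with P show ?thesis
    by blast
qed

text \<open>Finite additivity over the values of the pair of states at the two times. Measurability
  into \<open>count_space S\<close> keeps the chain inside \<open>S\<close> at every point of the
  space, so no exceptional set appears.\<close>

lemma markov_chain_sum_prob:
  assumes X: "markov_chain M S q \<rho> X" and "finite S" and "0 \<le> t" and "0 \<le> u"
  shows "\<P>(\<omega> in M. X t \<omega> \<in> B \<and> X u \<omega> \<in> C) =
    (\<Sum>x\<in>S \<inter> B. \<Sum>y\<in>S \<inter> C. \<P>(\<omega> in M. X t \<omega> = x \<and> X u \<omega> = y))"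
proof -
  interpret prob_space M
    using X by (simp add: markov_chain_def)
  have meas: "X s \<in> measurable M (count_space S)" if "0 \<le> s" for s
    using X that by (simp add: markov_chain_def)
  note sets = markov_chain_sets[OF X]
  have inS: "X s \<omega> \<in> S" if "0 \<le> s" "\<omega> \<in> space M" for s \<omega>
    using measurable_space[OF meas] that by fastforce
  let ?E = "\<lambda>(x, y). {\<omega> \<in> space M. X t \<omega> = x \<and> X u \<omega> = y}"
  have "{\<omega> \<in> space M. X t \<omega> \<in> B \<and> X u \<omega> \<in> C} = (\<Union>p\<in>(S \<inter> B) \<times> (S \<inter> C). ?E p)"
    using inS assms by auto
  moreover have "?E p \<in> sets M" if "p \<in> (S \<inter> B) \<times> (S \<inter> C)" for p
  proof -
    have "?E p = {\<omega> \<in> space M. X t \<omega> = fst p} \<inter> {\<omega> \<in> space M. X u \<omega> = snd p}"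
      by (auto simp: case_prod_unfold)
    then show ?thesis
      using sets[of t "fst p"] sets[of u "snd p"] that assms by auto
  qed
  moreover have "disjoint_family_on ?E ((S \<inter> B) \<times> (S \<inter> C))"
    by (auto simp: disjoint_family_on_def)
  ultimately have "\<P>(\<omega> in M. X t \<omega> \<in> B \<and> X u \<omega> \<in> C) = (\<Sum>p\<in>(S \<inter> B) \<times> (S \<inter> C). prob (?E p))"
    using \<open>finite S\<close> by (simp add: finite_measure_finite_Union image_subset_iff)
  then show ?thesis
    by (simp add: sum.cartesian_product case_prod_unfold)
qed

text \<open>The two-time formula with both times equal to \<open>t\<close>; the inner sum collapses
  to its diagonal term.\<close>

lemma markov_chain_sum_prob_single:
  assumes X: "markov_chain M S q \<rho> X" and "finite S" and "0 \<le> t"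
  shows "\<P>(\<omega> in M. X t \<omega> \<in> B) = (\<Sum>x\<in>S \<inter> B. \<P>(\<omega> in M. X t \<omega> = x))"
proof -
  have "\<P>(\<omega> in M. X t \<omega> \<in> B) = \<P>(\<omega> in M. X t \<omega> \<in> B \<and> X t \<omega> \<in> UNIV)"
    by simp
  also have "\<dots> = (\<Sum>x\<in>S \<inter> B. \<Sum>y\<in>S. \<P>(\<omega> in M. X t \<omega> = x \<and> X t \<omega> = y))"
    using markov_chain_sum_prob[OF assms assms(3), of B UNIV] by simp
  also have "\<dots> = (\<Sum>x\<in>S \<inter> B. \<P>(\<omega> in M. X t \<omega> = x))"
  proof (rule sum.cong)
    fix x assume x: "x \<in> S \<inter> B"
    have "(\<Sum>y\<in>S. \<P>(\<omega> in M. X t \<omega> = x \<and> X t \<omega> = y)) =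
        (\<Sum>y\<in>S. if y = x then \<P>(\<omega> in M. X t \<omega> = x) else 0)"
    proof (intro sum.cong refl)
      fix y
      show "\<P>(\<omega> in M. X t \<omega> = x \<and> X t \<omega> = y) = (if y = x then \<P>(\<omega> in M. X t \<omega> = x) else 0)"
      proof (cases "y = x")
        case False
        then have "{\<omega> \<in> space M. X t \<omega> = x \<and> X t \<omega> = y} = {}"
          by auto
        with False show ?thesis
          by (simp only: measure_empty if_False)
      qed simp
    qed
    with x \<open>finite S\<close> show "(\<Sum>y\<in>S. \<P>(\<omega> in M. X t \<omega> = x \<and> X t \<omega> = y)) = \<P>(\<omega> in M. X t \<omega> = x)"
      by simp
  qed simp
  finally show ?thesis .
qed

text \<open>The conditional probability is a weighted average of transition probabilities, and
  finite sums commute with the limit. Since \<open>r \<notin> A\<close>, only transitions between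
  distinct states occur, and exactly for these \<open>q\<close> gives the derivative at
  \<open>0\<close>.\<close>

lemma markov_chain_has_rate:
  fixes g :: "'s \<Rightarrow> nat"
  assumes X: "markov_chain M S q \<rho> X" and "finite S" and "0 \<le> t" and "r \<notin> A"
  shows "has_rate M (\<lambda>s \<omega>. g (X s \<omega>)) t r A
    ((\<Sum>x\<in>S \<inter> g -` {r}. \<P>(\<omega> in M. X t \<omega> = x) * (\<Sum>y\<in>S \<inter> g -` A. q x y)) /
      \<P>(\<omega> in M. g (X t \<omega>) = r))"
proof -
  obtain P where P: "transition_semigroup S q P"
    and joint: "\<And>t h x y. \<lbrakk>0 \<le> t; 0 \<le> h; x \<in> S; y \<in> S\<rbrakk> \<Longrightarrow>
      \<P>(\<omega> in M. X t \<omega> = x \<and> X (t + h) \<omega> = y) = \<P>(\<omega> in M. X t \<omega> = x) * pmf (P h x) y"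
    using markov_chain_joint_law[OF X] by blast
  \<comment> \<open>If \<open>?p = 0\<close>, the conditional probability and the claimed rate are
    both \<open>0\<close>, by the convention for division by zero.\<close>
  let ?p = "\<P>(\<omega> in M. g (X t \<omega>) = r)"
  let ?f = "\<lambda>h. (\<Sum>x\<in>S \<inter> g -` {r}. \<P>(\<omega> in M. X t \<omega> = x) *
    (\<Sum>y\<in>S \<inter> g -` A. pmf (P h x) y / h)) / ?p"
  have "((\<lambda>h. pmf (P h x) y / h) \<longlongrightarrow> q x y) (at_right 0)"
    if "x \<in> S \<inter> g -` {r}" "y \<in> S \<inter> g -` A" for x y
  proof -
    have "x \<in> S" "y \<in> S" "x \<noteq> y"
      using that \<open>r \<notin> A\<close> by auto
    then show ?thesis
      using P by (simp add: transition_semigroup_def)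
  qed
  then have "((\<lambda>h. \<Sum>y\<in>S \<inter> g -` A. pmf (P h x) y / h) \<longlongrightarrow> (\<Sum>y\<in>S \<inter> g -` A. q x y)) (at_right 0)"
    if "x \<in> S \<inter> g -` {r}" for x
    using that by (intro tendsto_sum)
  then have lim: "((\<lambda>h. \<P>(\<omega> in M. X t \<omega> = x) * (\<Sum>y\<in>S \<inter> g -` A. pmf (P h x) y / h)) \<longlongrightarrow>
      \<P>(\<omega> in M. X t \<omega> = x) * (\<Sum>y\<in>S \<inter> g -` A. q x y)) (at_right 0)"
    if "x \<in> S \<inter> g -` {r}" for x
    using that by (intro tendsto_mult_left)
  have "((\<lambda>h. \<Sum>x\<in>S \<inter> g -` {r}. \<P>(\<omega> in M. X t \<omega> = x) *
      (\<Sum>y\<in>S \<inter> g -` A. pmf (P h x) y / h)) \<longlongrightarrow>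
      (\<Sum>x\<in>S \<inter> g -` {r}. \<P>(\<omega> in M. X t \<omega> = x) * (\<Sum>y\<in>S \<inter> g -` A. q x y))) (at_right 0)"
    by (rule tendsto_sum) (rule lim)
  from tendsto_mult_right[OF this, of "inverse ?p"]
  have "(?f \<longlongrightarrow> (\<Sum>x\<in>S \<inter> g -` {r}. \<P>(\<omega> in M. X t \<omega> = x) *
      (\<Sum>y\<in>S \<inter> g -` A. q x y)) / ?p) (at_right 0)"
    by (simp only: divide_inverse)
  moreover have "\<forall>\<^sub>F h in at_right 0.
      ?f h = \<P>(\<omega> in M. g (X (t + h) \<omega>) \<in> A \<bar> g (X t \<omega>) = r) / h"
    using eventually_at_right_less[of "0::real"]
  proof eventually_elim
    case (elim h)
    have "\<P>(\<omega> in M. g (X (t + h) \<omega>) \<in> A \<and> g (X t \<omega>) = r) =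
        \<P>(\<omega> in M. X t \<omega> \<in> g -` {r} \<and> X (t + h) \<omega> \<in> g -` A)"
      by (rule arg_cong[where f = "measure M"]) auto
    also have "\<dots> = (\<Sum>x\<in>S \<inter> g -` {r}. \<Sum>y\<in>S \<inter> g -` A. \<P>(\<omega> in M. X t \<omega> = x \<and> X (t + h) \<omega> = y))"
      using elim \<open>0 \<le> t\<close> by (intro markov_chain_sum_prob[OF X \<open>finite S\<close>]) auto
    also have "\<dots> = (\<Sum>x\<in>S \<inter> g -` {r}. \<P>(\<omega> in M. X t \<omega> = x) * (\<Sum>y\<in>S \<inter> g -` A. pmf (P h x) y))"
      unfolding sum_distrib_left using elim \<open>0 \<le> t\<close> by (intro sum.cong refl joint) auto
    finally have quot: "\<P>(\<omega> in M. g (X (t + h) \<omega>) \<in> A \<and> g (X t \<omega>) = r) / h =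
        (\<Sum>x\<in>S \<inter> g -` {r}. \<P>(\<omega> in M. X t \<omega> = x) * (\<Sum>y\<in>S \<inter> g -` A. pmf (P h x) y / h))"
      by (simp only: sum_divide_distrib[symmetric] times_divide_eq_right)
    show ?case
      unfolding cond_prob_def quot[symmetric] by (simp add: mult.commute)
  qed
  ultimately show ?thesis
    unfolding has_rate_def by (rule Lim_transform_eventually)
qed

text \<open>An average of equal values is that value: the weights sum to the probability of
  \<open>g (X t \<omega>) = r\<close>, which cancels because it is positive.\<close>

lemma markov_chain_has_const_rate:
  fixes g :: "'s \<Rightarrow> nat"
  assumes X: "markov_chain M S q \<rho> X" and "finite S" and "0 \<le> t" and "r \<notin> A"
    and l: "\<And>x. x \<in> S \<Longrightarrow> g x = r \<Longrightarrow> (\<Sum>y\<in>S \<inter> g -` A. q x y) = l"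
    and pos: "\<P>(\<omega> in M. g (X t \<omega>) = r) > 0"
  shows "has_rate M (\<lambda>s \<omega>. g (X s \<omega>)) t r A l"
proof -
  have "(\<Sum>x\<in>S \<inter> g -` {r}. \<P>(\<omega> in M. X t \<omega> = x) * (\<Sum>y\<in>S \<inter> g -` A. q x y)) =
      (\<Sum>x\<in>S \<inter> g -` {r}. \<P>(\<omega> in M. X t \<omega> = x)) * l"
    using l by (simp add: sum_distrib_right)
  also have "(\<Sum>x\<in>S \<inter> g -` {r}. \<P>(\<omega> in M. X t \<omega> = x)) = \<P>(\<omega> in M. g (X t \<omega>) = r)"
    using markov_chain_sum_prob_single[OF X \<open>finite S\<close> \<open>0 \<le> t\<close>, of "g -` {r}"] by simp
  finally show ?thesis
    using markov_chain_has_rate[OF X \<open>finite S\<close> \<open>0 \<le> t\<close> \<open>r \<notin> A\<close>, of g] pos by simp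
qed

text \<open>At time \<open>0\<close> the average consists of the single state \<open>x\<close>. This
  is how the total rate of an individual state is recovered from the rates of the induced
  process.\<close>

lemma markov_chain_deterministic_start:
  fixes g :: "'s \<Rightarrow> nat"
  assumes X: "markov_chain M S q (return_pmf x) X" and "finite S" and "x \<in> S" and "g x \<notin> A"
  shows "\<P>(\<omega> in M. g (X 0 \<omega>) = g x) > 0"
    and "has_rate M (\<lambda>s \<omega>. g (X s \<omega>)) 0 (g x) A (\<Sum>y\<in>S \<inter> g -` A. q x y)"
proof -
  have p0: "\<P>(\<omega> in M. X 0 \<omega> = y) = (if y = x then 1 else 0)" if "y \<in> S" for y
    using X that by (simp add: markov_chain_def indicator_def)
  have "\<P>(\<omega> in M. g (X 0 \<omega>) = g x) = (\<Sum>y\<in>S \<inter> g -` {g x}. \<P>(\<omega> in M. X 0 \<omega> = y))"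
    using markov_chain_sum_prob_single[OF X \<open>finite S\<close>, of 0 "g -` {g x}"] by simp
  also have "\<dots> = 1"
    using \<open>finite S\<close> \<open>x \<in> S\<close> by (simp add: p0)
  finally have one: "\<P>(\<omega> in M. g (X 0 \<omega>) = g x) = 1" .
  then show "\<P>(\<omega> in M. g (X 0 \<omega>) = g x) > 0"
    by simp
  have "(\<Sum>y\<in>S \<inter> g -` {g x}. \<P>(\<omega> in M. X 0 \<omega> = y) * (\<Sum>z\<in>S \<inter> g -` A. q y z)) =
      (\<Sum>y\<in>S \<inter> g -` {g x}. if y = x then \<Sum>z\<in>S \<inter> g -` A. q x z else 0)"
    by (intro sum.cong refl) (auto simp: p0)
  also have "\<dots> = (\<Sum>z\<in>S \<inter> g -` A. q x z)"
    using \<open>finite S\<close> \<open>x \<in> S\<close> by simp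
  finally show "has_rate M (\<lambda>s \<omega>. g (X s \<omega>)) 0 (g x) A (\<Sum>y\<in>S \<inter> g -` A. q x y)"
    using markov_chain_has_rate[OF X \<open>finite S\<close> order_refl \<open>g x \<notin> A\<close>, where g = g] one by simp
qed

lemma has_rate_unique:
  assumes "has_rate M Y t r A l" and "has_rate M Y t r A l'"
  shows "l = l'"
  using assms unfolding has_rate_def by (intro tendsto_unique[of "at_right (0::real)"]) auto


section \<open>Total coagulation and fragmentation rates\<close>

definition total_coag_rate :: "nat \<Rightarrow> (nat \<Rightarrow> nat \<Rightarrow> real) \<Rightarrow> state \<Rightarrow> real" where
  "total_coag_rate N \<psi> \<eta> = (\<Sum>(i, j)\<in>size_pairs N. coagulation_rate \<psi> \<eta> i j)"

definition total_frag_rate :: "nat \<Rightarrow> (nat \<Rightarrow> nat \<Rightarrow> real) \<Rightarrow> state \<Rightarrow> real" where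
  "total_frag_rate N \<phi> \<eta> = (\<Sum>(i, j)\<in>size_pairs N. fragmentation_rate \<phi> \<eta> i j)"

section \<open>Elementary bounds for partitions\<close>

lemma partitions_mult_le:
  assumes "\<eta> \<in> partitions N"
  shows "i * \<eta> i \<le> N"
proof (cases "i \<in> {1..N}")
  case True
  have "i * \<eta> i \<le> (\<Sum>i=1..N. i * \<eta> i)"
    using True by (intro member_le_sum) auto
  then show ?thesis
    using assms by (simp add: partitions_def)
next
  case False
  then show ?thesis
    using assms by (auto simp: partitions_def)
qed

lemma partitions_mult_add_le:
  assumes "\<eta> \<in> partitions N" and "i \<noteq> j"
  shows "i * \<eta> i + j * \<eta> j \<le> N"
proof (cases "i \<in> {1..N} \<and> j \<in> {1..N}")
  case True
  have "(\<Sum>i\<in>{i, j}. i * \<eta> i) \<le> (\<Sum>i=1..N. i * \<eta> i)"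
    using True by (intro sum_mono2) auto
  then show ?thesis
    using assms by (simp add: partitions_def)
next
  case False
  then have "\<eta> i = 0 \<or> \<eta> j = 0"
    using assms by (auto simp: partitions_def)
  then show ?thesis
    using partitions_mult_le[OF assms(1)] by auto
qed

text \<open>Multiplicities of sizes \<open>i \<ge> 1\<close> are at most \<open>N\<close>, so
  partitions are among the finitely many functions from \<open>{1..N}\<close> to
  \<open>{..N}\<close> extended by zero.\<close>

lemma finite_partitions [simp]: "finite (partitions N)"
proof (rule finite_subset)
  show "partitions N \<subseteq> {\<eta>. \<forall>i. (i \<in> {1..N} \<longrightarrow> \<eta> i \<in> {..N}) \<and> (i \<notin> {1..N} \<longrightarrow> \<eta> i = 0)}"
  proof
    fix \<eta> assume \<eta>: "\<eta> \<in> partitions N"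
    have "\<eta> i \<le> N" if "1 \<le> i" for i
    proof -
      have "\<eta> i \<le> i * \<eta> i"
        using that by (cases i) auto
      also have "\<dots> \<le> N"
        by (rule partitions_mult_le[OF \<eta>])
      finally show ?thesis .
    qed
    with \<eta> show "\<eta> \<in> {\<eta>. \<forall>i. (i \<in> {1..N} \<longrightarrow> \<eta> i \<in> {..N}) \<and> (i \<notin> {1..N} \<longrightarrow> \<eta> i = 0)}"
      by (simp add: partitions_def)
  qed
qed (intro finite_set_of_finite_funs; simp)

lemma groups_partitions_bounds:
  assumes "\<eta> \<in> partitions N" and "1 \<le> N"
  shows "1 \<le> groups N \<eta>" and "groups N \<eta> \<le> N"
proof -
  have "groups N \<eta> \<le> (\<Sum>i=1..N. i * \<eta> i)"
    unfolding groups_def by (intro sum_mono) auto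
  then show "groups N \<eta> \<le> N"
    using assms by (simp add: partitions_def)
  have "groups N \<eta> \<noteq> 0"
  proof
    assume "groups N \<eta> = 0"
    then have "(\<Sum>i=1..N. i * \<eta> i) = 0"
      by (simp add: groups_def)
    then show False
      using assms by (simp add: partitions_def)
  qed
  then show "1 \<le> groups N \<eta>"
    by simp
qed

section \<open>Effect of a single transition on size and number of groups\<close>

text \<open>A nonzero rate means that the groups to be merged are present, at least two of them if
  \<open>i = j\<close>, so no subtraction in \<open>merge\<close> is truncated.\<close>

lemma merge_partitions:
  assumes \<eta>: "\<eta> \<in> partitions N" and ij: "(i, j) \<in> size_pairs N"
    and pos: "coagulation_rate \<psi> \<eta> i j \<noteq> 0"
  shows "merge i j \<eta> \<in> partitions N" and "groups N (merge i j \<eta>) + 1 = groups N \<eta>"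
proof -
  \<comment> \<open>Moving the removed groups to the left gives an identity of natural numbers
    without subtraction.\<close>
  have balance: "merge i j \<eta> k + (of_bool (k = i) + of_bool (k = j)) = \<eta> k + of_bool (k = i + j)" for k
  proof (cases "i = j")
    case True
    then have "2 \<le> \<eta> i"
      using pos by (cases "\<eta> i"; cases "\<eta> i - 1") (auto simp: coagulation_rate_def)
    with True ij show ?thesis
      by (auto simp: merge_def size_pairs_def)
  next
    case False
    then have "1 \<le> \<eta> i" "1 \<le> \<eta> j"
      using pos by (auto simp: coagulation_rate_def Suc_le_eq intro: ccontr)
    with False ij show ?thesis
      by (auto simp: merge_def size_pairs_def)
  qed
  \<comment> \<open>The weight \<open>f k = k\<close> will give conservation of the total size, the
    weight \<open>1\<close> the change in the number of groups.\<close>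
  have sum: "(\<Sum>k=1..N. f k * merge i j \<eta> k) + (f i + f j) = (\<Sum>k=1..N. f k * \<eta> k) + f (i + j)"
    for f :: "nat \<Rightarrow> nat"
  proof -
    have "(\<Sum>k=1..N. f k * (merge i j \<eta> k + (of_bool (k = i) + of_bool (k = j)))) =
        (\<Sum>k=1..N. f k * (\<eta> k + of_bool (k = i + j)))"
      by (simp only: balance)
    then show ?thesis
      using ij by (simp add: distrib_left sum.distrib size_pairs_def)
  qed
  have "merge i j \<eta> k = 0" if "k \<notin> {1..N}" for k
    using balance[of k] that \<eta> ij by (auto simp: partitions_def size_pairs_def)
  then show "merge i j \<eta> \<in> partitions N"
    using sum[of "\<lambda>k. k"] \<eta> by (simp add: partitions_def)
  show "groups N (merge i j \<eta>) + 1 = groups N \<eta>"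
    using sum[of "\<lambda>_. 1"] by (simp add: groups_def)
qed

text \<open>The same balance argument as for merging: a nonzero rate means that a group of size
  \<open>i + j\<close> is present.\<close>

lemma split_partitions:
  assumes \<eta>: "\<eta> \<in> partitions N" and ij: "(i, j) \<in> size_pairs N"
    and pos: "fragmentation_rate \<phi> \<eta> i j \<noteq> 0"
  shows "split i j \<eta> \<in> partitions N" and "groups N (split i j \<eta>) = groups N \<eta> + 1"
proof -
  have balance: "split i j \<eta> k + of_bool (k = i + j) = \<eta> k + (of_bool (k = i) + of_bool (k = j))" for k
    using pos ij by (auto simp: split_def fragmentation_rate_def size_pairs_def)
  have sum: "(\<Sum>k=1..N. f k * split i j \<eta> k) + f (i + j) = (\<Sum>k=1..N. f k * \<eta> k) + (f i + f j)"
    for f :: "nat \<Rightarrow> nat"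
  proof -
    have "(\<Sum>k=1..N. f k * (split i j \<eta> k + of_bool (k = i + j))) =
        (\<Sum>k=1..N. f k * (\<eta> k + (of_bool (k = i) + of_bool (k = j))))"
      by (simp only: balance)
    then show ?thesis
      using ij by (simp add: distrib_left sum.distrib size_pairs_def)
  qed
  have "split i j \<eta> k = 0" if "k \<notin> {1..N}" for k
    using balance[of k] that \<eta> ij by (auto simp: partitions_def size_pairs_def)
  then show "split i j \<eta> \<in> partitions N"
    using sum[of "\<lambda>k. k"] \<eta> by (simp add: partitions_def)
  show "groups N (split i j \<eta>) = groups N \<eta> + 1"
    using sum[of "\<lambda>_. 1"] by (simp add: groups_def)
qed

text \<open>After exchanging the sums, each pair of sizes has one merged and one split target. If
  its rate is nonzero, the target is a partition whose number of groups decides membership in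
  \<open>A\<close>; if the rate is zero, the target does not matter.\<close>

lemma sum_cfp_rate:
  assumes \<eta>: "\<eta> \<in> partitions N" and "1 \<le> N"
  shows "(\<Sum>\<zeta>\<in>partitions N \<inter> groups N -` A. cfp_rate N \<psi> \<phi> \<eta> \<zeta>) =
    (if groups N \<eta> - 1 \<in> A then total_coag_rate N \<psi> \<eta> else 0) +
    (if groups N \<eta> + 1 \<in> A then total_frag_rate N \<phi> \<eta> else 0)"
proof -
  let ?S = "partitions N \<inter> groups N -` A"
  have fin: "finite ?S"
    by simp
  have m: "(\<Sum>\<zeta>\<in>?S. if \<zeta> = merge i j \<eta> then coagulation_rate \<psi> \<eta> i j else 0) =
      (if groups N \<eta> - 1 \<in> A then coagulation_rate \<psi> \<eta> i j else 0)"
    if "(i, j) \<in> size_pairs N" for i j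
  proof (cases "coagulation_rate \<psi> \<eta> i j = 0")
    case False
    then have "merge i j \<eta> \<in> partitions N" "groups N (merge i j \<eta>) = groups N \<eta> - 1"
      using merge_partitions[OF \<eta> that False] by auto
    then show ?thesis
      using fin by (simp add: sum.delta)
  qed (simp cong: if_cong)
  have s: "(\<Sum>\<zeta>\<in>?S. if \<zeta> = split i j \<eta> then fragmentation_rate \<phi> \<eta> i j else 0) =
      (if groups N \<eta> + 1 \<in> A then fragmentation_rate \<phi> \<eta> i j else 0)"
    if "(i, j) \<in> size_pairs N" for i j
  proof (cases "fragmentation_rate \<phi> \<eta> i j = 0")
    case False
    then have "split i j \<eta> \<in> partitions N" "groups N (split i j \<eta>) = groups N \<eta> + 1"
      using split_partitions[OF \<eta> that False] by auto
    then show ?thesis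
      using fin by (simp add: sum.delta)
  qed (simp cong: if_cong)
  have "(\<Sum>\<zeta>\<in>?S. cfp_rate N \<psi> \<phi> \<eta> \<zeta>) = (\<Sum>(i, j)\<in>size_pairs N.
      (\<Sum>\<zeta>\<in>?S. if \<zeta> = merge i j \<eta> then coagulation_rate \<psi> \<eta> i j else 0) +
      (\<Sum>\<zeta>\<in>?S. if \<zeta> = split i j \<eta> then fragmentation_rate \<phi> \<eta> i j else 0))"
    unfolding cfp_rate_def case_prod_unfold by (subst sum.swap) (simp only: sum.distrib)
  also have "\<dots> = (\<Sum>(i, j)\<in>size_pairs N.
      (if groups N \<eta> - 1 \<in> A then coagulation_rate \<psi> \<eta> i j else 0) +
      (if groups N \<eta> + 1 \<in> A then fragmentation_rate \<phi> \<eta> i j else 0))"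
    by (intro sum.cong refl) (clarsimp simp only: m s split: prod.split)
  finally show ?thesis
    by (simp add: total_coag_rate_def total_frag_rate_def case_prod_unfold sum.distrib)
qed

section \<open>Time homogeneity expressed by total rates\<close>

text \<open>From left to right, start at a single partition and use uniqueness of limits at time
  \<open>0\<close>; from right to left, an average of a constant total rate is that constant for
  every time and every initial law. This removes probability from the rest of the argument.\<close>

lemma time_homogeneous_birth_death_groups_iff:
  assumes CFP: "is_CFP N \<psi> \<phi> M X" and N: "1 \<le> N"
  shows "time_homogeneous_birth_death N M (\<lambda>\<rho> t \<omega>. groups N (X \<rho> t \<omega>)) \<longleftrightarrow>
    (\<forall>r. 1 \<le> r \<and> r + 1 \<le> N \<longrightarrow>
      (\<exists>l. \<forall>\<eta>\<in>partitions N. groups N \<eta> = r \<longrightarrow> total_frag_rate N \<phi> \<eta> = l)) \<and>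
    (\<forall>r. 2 \<le> r \<and> r \<le> N \<longrightarrow>
      (\<exists>l. \<forall>\<eta>\<in>partitions N. groups N \<eta> = r \<longrightarrow> total_coag_rate N \<psi> \<eta> = l))"
    (is "?L \<longleftrightarrow> ?F \<and> ?K")
proof -
  have mc: "markov_chain (M \<rho>) (partitions N) (cfp_rate N \<psi> \<phi>) \<rho> (X \<rho>)" if "\<rho> \<in> initial_laws N" for \<rho>
    using CFP that by (simp add: is_CFP_def)
  have ret: "return_pmf \<eta> \<in> initial_laws N" if "\<eta> \<in> partitions N" for \<eta>
    using that by (simp add: initial_laws_def)
  note start = markov_chain_deterministic_start[OF mc[OF ret] finite_partitions]
  show ?thesis
  proof (intro iffI conjI)
    assume L: ?L
    show ?F
    proof (intro allI impI)
      fix r assume r: "1 \<le> r \<and> r + 1 \<le> N"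
      with L have "\<exists>l. \<forall>\<rho>\<in>initial_laws N. \<forall>t\<ge>0. \<P>(\<omega> in M \<rho>. groups N (X \<rho> t \<omega>) = r) > 0 \<longrightarrow>
          has_rate (M \<rho>) (\<lambda>t \<omega>. groups N (X \<rho> t \<omega>)) t r {r + 1} l"
        unfolding time_homogeneous_birth_death_def has_birth_rate_def by blast
      then obtain l where l: "\<And>\<rho> t. \<lbrakk>\<rho> \<in> initial_laws N; 0 \<le> t;
          \<P>(\<omega> in M \<rho>. groups N (X \<rho> t \<omega>) = r) > 0\<rbrakk> \<Longrightarrow>
          has_rate (M \<rho>) (\<lambda>t \<omega>. groups N (X \<rho> t \<omega>)) t r {r + 1} l"
        by blast
      have "total_frag_rate N \<phi> \<eta> = l" if \<eta>: "\<eta> \<in> partitions N" "groups N \<eta> = r" for \<eta>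
      proof -
        have "r \<notin> {r + 1}" "r - 1 \<noteq> r + 1" by auto
        then have "has_rate (M (return_pmf \<eta>)) (\<lambda>s \<omega>. groups N (X (return_pmf \<eta>) s \<omega>)) 0 r {r + 1}
            (total_frag_rate N \<phi> \<eta>)"
          using start(2)[OF \<eta>(1) \<eta>(1), of "groups N" "{r + 1}"] \<eta>(2)
          by (simp add: sum_cfp_rate[OF \<eta>(1) N])
        moreover have "has_rate (M (return_pmf \<eta>)) (\<lambda>s \<omega>. groups N (X (return_pmf \<eta>) s \<omega>)) 0 r {r + 1} l"
          \<comment> \<open>Taking \<open>{}\<close> for \<open>A\<close> makes the side condition
            \<open>g x \<notin> A\<close> trivial.\<close>
          using l[OF ret[OF \<eta>(1)], of 0] start(1)[OF \<eta>(1) \<eta>(1), of "groups N" "{}"] \<eta>(2) by simp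
        ultimately show ?thesis
          by (rule has_rate_unique)
      qed
      then show "\<exists>l. \<forall>\<eta>\<in>partitions N. groups N \<eta> = r \<longrightarrow> total_frag_rate N \<phi> \<eta> = l"
        by blast
    qed
    show ?K
    proof (intro allI impI)
      fix r assume r: "2 \<le> r \<and> r \<le> N"
      with L have "\<exists>l. \<forall>\<rho>\<in>initial_laws N. \<forall>t\<ge>0. \<P>(\<omega> in M \<rho>. groups N (X \<rho> t \<omega>) = r) > 0 \<longrightarrow>
          has_rate (M \<rho>) (\<lambda>t \<omega>. groups N (X \<rho> t \<omega>)) t r {r - 1} l"
        unfolding time_homogeneous_birth_death_def has_death_rate_def by blast
      then obtain l where l: "\<And>\<rho> t. \<lbrakk>\<rho> \<in> initial_laws N; 0 \<le> t;
          \<P>(\<omega> in M \<rho>. groups N (X \<rho> t \<omega>) = r) > 0\<rbrakk> \<Longrightarrow>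
          has_rate (M \<rho>) (\<lambda>t \<omega>. groups N (X \<rho> t \<omega>)) t r {r - 1} l"
        by blast
      have "total_coag_rate N \<psi> \<eta> = l" if \<eta>: "\<eta> \<in> partitions N" "groups N \<eta> = r" for \<eta>
      proof -
        \<comment> \<open>On natural numbers \<open>r - 1 = r\<close> for \<open>r = 0\<close>; the
          bound \<open>2 \<le> r\<close> excludes this.\<close>
        have "r \<notin> {r - 1}" "r + 1 \<noteq> r - 1" using r by auto
        then have "has_rate (M (return_pmf \<eta>)) (\<lambda>s \<omega>. groups N (X (return_pmf \<eta>) s \<omega>)) 0 r {r - 1}
            (total_coag_rate N \<psi> \<eta>)"
          using start(2)[OF \<eta>(1) \<eta>(1), of "groups N" "{r - 1}"] \<eta>(2)
          by (simp add: sum_cfp_rate[OF \<eta>(1) N])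
        moreover have "has_rate (M (return_pmf \<eta>)) (\<lambda>s \<omega>. groups N (X (return_pmf \<eta>) s \<omega>)) 0 r {r - 1} l"
          using l[OF ret[OF \<eta>(1)], of 0] start(1)[OF \<eta>(1) \<eta>(1), of "groups N" "{}"] \<eta>(2) by simp
        ultimately show ?thesis
          by (rule has_rate_unique)
      qed
      then show "\<exists>l. \<forall>\<eta>\<in>partitions N. groups N \<eta> = r \<longrightarrow> total_coag_rate N \<psi> \<eta> = l"
        by blast
    qed
  next
    assume FK: "?F \<and> ?K"
    note rate = markov_chain_has_const_rate[OF mc finite_partitions, where g = "groups N"]
    show ?L
      unfolding time_homogeneous_birth_death_def has_birth_rate_def has_death_rate_def
    proof (intro conjI allI impI ballI)
      fix r \<rho> t
      assume "\<rho> \<in> initial_laws N" "0 \<le> t" "\<P>(\<omega> in M \<rho>. groups N (X \<rho> t \<omega>) = r) > 0"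
      \<comment> \<open>Every transition changes the number of groups by exactly one, so both terms
        of \<open>sum_cfp_rate\<close> vanish for this set.\<close>
      then show "has_rate (M \<rho>) (\<lambda>t \<omega>. groups N (X \<rho> t \<omega>)) t r (- {r - 1..r + 1}) 0"
        by (intro rate) (auto simp: sum_cfp_rate[OF _ N])
    next
      fix r assume r: "1 \<le> r \<and> r + 1 \<le> N"
      with FK obtain l where l: "\<And>\<eta>. \<eta> \<in> partitions N \<Longrightarrow> groups N \<eta> = r \<Longrightarrow> total_frag_rate N \<phi> \<eta> = l"
        by metis
      show "\<exists>l. \<forall>\<rho>\<in>initial_laws N. \<forall>t\<ge>0. \<P>(\<omega> in M \<rho>. groups N (X \<rho> t \<omega>) = r) > 0 \<longrightarrow>
          has_rate (M \<rho>) (\<lambda>t \<omega>. groups N (X \<rho> t \<omega>)) t r {r + 1} l"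
        by (intro exI[of _ l] ballI allI impI rate) (auto simp: sum_cfp_rate[OF _ N] l)
    next
      fix r assume r: "2 \<le> r \<and> r \<le> N"
      with FK obtain l where l: "\<And>\<eta>. \<eta> \<in> partitions N \<Longrightarrow> groups N \<eta> = r \<Longrightarrow> total_coag_rate N \<psi> \<eta> = l"
        by metis
      show "\<exists>l. \<forall>\<rho>\<in>initial_laws N. \<forall>t\<ge>0. \<P>(\<omega> in M \<rho>. groups N (X \<rho> t \<omega>) = r) > 0 \<longrightarrow>
          has_rate (M \<rho>) (\<lambda>t \<omega>. groups N (X \<rho> t \<omega>)) t r {r - 1} l"
        using r by (intro exI[of _ l] ballI allI impI rate) (auto simp: sum_cfp_rate[OF _ N] l)
    qed
  qed
qed

section \<open>Total rates as sums over sizes\<close>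

text \<open>The triangle \<open>i \<le> j\<close> and its mirror image cover the square and overlap
  in the diagonal.\<close>

lemma sum_sum_symmetric:
  fixes g :: "'a::linorder \<Rightarrow> 'a \<Rightarrow> real"
  assumes "finite A" and "\<And>i j. i \<in> A \<Longrightarrow> j \<in> A \<Longrightarrow> g i j = g j i"
  shows "2 * (\<Sum>(i, j)\<in>{(i, j)\<in>A \<times> A. i \<le> j}. g i j) = (\<Sum>i\<in>A. \<Sum>j\<in>A. g i j) + (\<Sum>i\<in>A. g i i)"
proof -
  let ?U = "{(i, j)\<in>A \<times> A. i \<le> j}" and ?V = "{(i, j)\<in>A \<times> A. j \<le> i}"
  have fin: "finite ?U" "finite ?V"
    using assms(1) by (auto intro: finite_subset[of _ "A \<times> A"])
  have "(\<Sum>(i, j)\<in>?V. g i j) = (\<Sum>(i, j)\<in>?U. g i j)"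
    using assms(2) by (intro sum.reindex_bij_witness[of _ prod.swap prod.swap]) auto
  moreover have "?U \<union> ?V = A \<times> A"
    by auto
  moreover have "(\<Sum>(i, j)\<in>?U \<inter> ?V. g i j) = (\<Sum>i\<in>A. g i i)"
    by (intro sum.reindex_bij_witness[of _ "\<lambda>i. (i, i)" fst]) auto
  ultimately show ?thesis
    using sum.union_inter[OF fin, of "\<lambda>(i, j). g i j"] by (simp add: sum.cartesian_product)
qed

text \<open>Twice the sum over unordered pairs of groups is the sum over all ordered pairs, less the
  pairing of each group with itself.\<close>

lemma total_coag_rate_eq:
  assumes \<eta>: "\<eta> \<in> partitions N"
    and sym: "\<And>i j. 1 \<le> i \<Longrightarrow> 1 \<le> j \<Longrightarrow> \<psi> i j = \<psi> j i"
  shows "2 * total_coag_rate N \<psi> \<eta> =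
    (\<Sum>i=1..N. real (\<eta> i) * (\<Sum>j=1..N. real (\<eta> j) * \<psi> i j)) - (\<Sum>i=1..N. real (\<eta> i) * \<psi> i i)"
proof -
  let ?c = "coagulation_rate \<psi> \<eta>"
  have zero: "?c i j = 0" if "1 \<le> i" "1 \<le> j" "N < i + j" for i j
  proof (cases "i = j")
    case True
    have "\<eta> i < 2"
    proof (rule ccontr)
      assume "\<not> \<eta> i < 2"
      then have "i * 2 \<le> i * \<eta> i" by simp
      also have "\<dots> \<le> N"
        by (rule partitions_mult_le[OF \<eta>])
      finally show False
        using that True by simp
    qed
    then have "\<eta> i = 0 \<or> \<eta> i = 1" by auto
    then show ?thesis
      using True by (auto simp: coagulation_rate_def)
  next
    case False
    have "\<eta> i = 0 \<or> \<eta> j = 0"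
    proof (rule ccontr)
      assume "\<not> (\<eta> i = 0 \<or> \<eta> j = 0)"
      then have "i + j \<le> i * \<eta> i + j * \<eta> j"
        by (intro add_mono) auto
      also have "\<dots> \<le> N"
        by (rule partitions_mult_add_le[OF \<eta> False])
      finally show False
        using that by simp
    qed
    then show ?thesis
      using False by (auto simp: coagulation_rate_def)
  qed
  have supp: "i + j \<le> N" if "1 \<le> i" "1 \<le> j" "?c i j \<noteq> 0" for i j
    using zero[OF that(1,2)] that(3) by force
  have "total_coag_rate N \<psi> \<eta> = (\<Sum>(i, j)\<in>{(i, j)\<in>{1..N} \<times> {1..N}. i \<le> j}. ?c i j)"
    unfolding total_coag_rate_def
    by (intro sum.mono_neutral_left) (auto simp: size_pairs_def intro: supp finite_subset[of _ "{1..N} \<times> {1..N}"])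
  then have "2 * total_coag_rate N \<psi> \<eta> = (\<Sum>i=1..N. \<Sum>j=1..N. ?c i j) + (\<Sum>i=1..N. ?c i i)"
    using sum_sum_symmetric[of "{1..N}" ?c] sym by (simp add: coagulation_rate_def mult_ac)
  \<comment> \<open>With \<open>n = \<eta> i\<close>, the diagonal correction is
    \<open>n^2 - n (n - 1) / 2 = n (n + 1) / 2\<close>; adding \<open>?c i i\<close> later leaves
    \<open>- n\<close>.\<close>
  also have "(\<Sum>i=1..N. \<Sum>j=1..N. ?c i j) =
      (\<Sum>i=1..N. \<Sum>j=1..N. real (\<eta> i) * real (\<eta> j) * \<psi> i j -
        (if i = j then real (\<eta> i) * (real (\<eta> i) + 1) / 2 * \<psi> i i else 0))"
    by (intro sum.cong refl) (auto simp: coagulation_rate_def field_simps)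
  also have "\<dots> = (\<Sum>i=1..N. (\<Sum>j=1..N. real (\<eta> i) * real (\<eta> j) * \<psi> i j) -
      real (\<eta> i) * (real (\<eta> i) + 1) / 2 * \<psi> i i)"
    by (intro sum.cong refl) (simp add: sum_subtractf)
  finally have "2 * total_coag_rate N \<psi> \<eta> =
      (\<Sum>i=1..N. (\<Sum>j=1..N. real (\<eta> i) * real (\<eta> j) * \<psi> i j) -
        real (\<eta> i) * (real (\<eta> i) + 1) / 2 * \<psi> i i + ?c i i)"
    by (simp only: sum.distrib)
  also have "\<dots> = (\<Sum>i=1..N. real (\<eta> i) * (\<Sum>j=1..N. real (\<eta> j) * \<psi> i j) - real (\<eta> i) * \<psi> i i)"
  proof (intro sum.cong refl)
    fix i
    have "(\<Sum>j=1..N. real (\<eta> i) * real (\<eta> j) * \<psi> i j) = real (\<eta> i) * (\<Sum>j=1..N. real (\<eta> j) * \<psi> i j)"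
      unfolding sum_distrib_left by (simp only: mult.assoc)
    moreover have "?c i i - real (\<eta> i) * (real (\<eta> i) + 1) / 2 * \<psi> i i = - (real (\<eta> i) * \<psi> i i)"
      by (simp add: coagulation_rate_def field_simps)
    ultimately show "(\<Sum>j=1..N. real (\<eta> i) * real (\<eta> j) * \<psi> i j) -
        real (\<eta> i) * (real (\<eta> i) + 1) / 2 * \<psi> i i + ?c i i =
        real (\<eta> i) * (\<Sum>j=1..N. real (\<eta> j) * \<psi> i j) - real (\<eta> i) * \<psi> i i"
      by linarith
  qed
  finally show ?thesis
    by (simp add: sum_subtractf)
qed

text \<open>The pairs in \<open>size_pairs N\<close> are sorted by the size \<open>k = i + j\<close>
  of the group being split; \<open>k = 1\<close> contributes the empty set.\<close>

lemma total_frag_rate_eq: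
  "total_frag_rate N \<phi> \<eta> = (\<Sum>k=1..N. real (\<eta> k) * total_fragmentation \<phi> k)"
proof -
  let ?B = "\<lambda>k. {(i, j). 1 \<le> i \<and> i \<le> j \<and> i + j = (k::nat)}"
  have fin: "finite (?B k)" for k
    by (rule finite_subset[of _ "{1..k} \<times> {1..k}"]) auto
  have "(\<Sum>k=1..N. real (\<eta> k) * total_fragmentation \<phi> k) =
      (\<Sum>k=1..N. \<Sum>(i, j)\<in>?B k. fragmentation_rate \<phi> \<eta> i j)"
    unfolding total_fragmentation_def fragmentation_rate_def sum_distrib_left
    by (intro sum.cong refl) auto
  also have "\<dots> = (\<Sum>p\<in>(\<Union>k\<in>{1..N}. ?B k). case p of (i, j) \<Rightarrow> fragmentation_rate \<phi> \<eta> i j)"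
    using fin by (intro sum.UNION_disjoint[symmetric]) auto
  also have "(\<Union>k\<in>{1..N}. ?B k) = size_pairs N"
    by (auto simp: size_pairs_def)
  finally show ?thesis
    by (simp add: total_frag_rate_def)
qed


section \<open>Partitions as multisets of group sizes\<close>

text \<open>Lets the rates of concrete partitions be evaluated by listing their groups as a short
  multiset.\<close>

lemma sum_count_mult:
  fixes f :: "'a \<Rightarrow> 'b::comm_semiring_1"
  assumes "finite S" and "set_mset A \<subseteq> S"
  shows "(\<Sum>i\<in>S. of_nat (count A i) * f i) = (\<Sum>x\<in>#A. f x)"
  using assms(2)
proof (induction A)
  case (add x A)
  have "(\<Sum>i\<in>S. of_nat (count (add_mset x A) i) * f i) =
      (\<Sum>i\<in>S. of_nat (count A i) * f i + (if i = x then f x else 0))"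
    by (intro sum.cong refl) (simp add: algebra_simps)
  then show ?case
    using add assms(1) by (simp add: sum.distrib add.commute)
qed simp

text \<open>Supplies the test partitions for the necessity proofs: any multiset of positive sizes,
  with its sum in the role of \<open>N\<close>.\<close>

lemma count_partitions:
  assumes "0 \<notin># A"
  shows "count A \<in> partitions (sum_mset A)" and "groups (sum_mset A) (count A) = size A"
    and "set_mset A \<subseteq> {1..sum_mset A}"
proof -
  show sub: "set_mset A \<subseteq> {1..sum_mset A}"
  proof
    fix x assume x: "x \<in># A"
    then obtain B where "A = add_mset x B"
      by (metis insert_DiffM)
    with x assms show "x \<in> {1..sum_mset A}"
      by (cases x) auto
  qed
  have "(\<Sum>i=1..sum_mset A. i * count A i) = sum_mset A"
    using sum_count_mult[OF _ sub, of "\<lambda>x. x"] by (simp add: mult.commute)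
  moreover have "count A i = 0" if "i \<notin> {1..sum_mset A}" for i
    using sub that by (auto simp: count_eq_zero_iff)
  ultimately show "count A \<in> partitions (sum_mset A)"
    by (auto simp: partitions_def)
  show "groups (sum_mset A) (count A) = size A"
    using sum_count_mult[OF _ sub, of "\<lambda>_. 1::nat"] by (simp add: groups_def)
qed

lemma total_coag_rate_count:
  assumes "0 \<notin># A" and "\<And>i j. 1 \<le> i \<Longrightarrow> 1 \<le> j \<Longrightarrow> \<psi> i j = \<psi> j i"
  shows "2 * total_coag_rate (sum_mset A) \<psi> (count A) =
    (\<Sum>x\<in>#A. \<Sum>y\<in>#A. \<psi> x y) - (\<Sum>x\<in>#A. \<psi> x x)"
proof -
  have "2 * total_coag_rate (sum_mset A) \<psi> (count A) =
      (\<Sum>i=1..sum_mset A. real (count A i) * (\<Sum>j=1..sum_mset A. real (count A j) * \<psi> i j)) -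
      (\<Sum>i=1..sum_mset A. real (count A i) * \<psi> i i)"
    by (rule total_coag_rate_eq[OF count_partitions(1)[OF assms(1)] assms(2)])
  then show ?thesis
    by (simp only: sum_count_mult[OF finite_atLeastAtMost count_partitions(3)[OF assms(1)]])
qed

lemma total_frag_rate_count:
  assumes "0 \<notin># A"
  shows "total_frag_rate (sum_mset A) \<phi> (count A) = (\<Sum>x\<in>#A. total_fragmentation \<phi> x)"
  unfolding total_frag_rate_eq
  by (rule sum_count_mult[OF finite_atLeastAtMost count_partitions(3)[OF assms]])


section \<open>Rates depending only on the number of groups\<close>

text \<open>Against an affine kernel, a partition enters only through the two linear functionals
  \<open>N\<close> and \<open>groups N \<eta>\<close>. Writing \<open>n\<close> for the latter, the
  double sum is \<open>2 a n N + b n^2\<close> and the diagonal is \<open>2 a N + b n\<close>; the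
  difference has the factor \<open>n - 1\<close>.\<close>

lemma total_coag_rate_affine:
  assumes \<eta>: "\<eta> \<in> partitions N"
    and \<psi>: "\<And>i j. 1 \<le> i \<Longrightarrow> 1 \<le> j \<Longrightarrow> \<psi> i j = a * (real i + real j) + b"
  shows "2 * total_coag_rate N \<psi> \<eta> =
    (real (groups N \<eta>) - 1) * (2 * a * real N + b * real (groups N \<eta>))"
proof -
  let ?n = "real (groups N \<eta>)"
  have n: "(\<Sum>i=1..N. real (\<eta> i)) = ?n"
    by (simp add: groups_def)
  have N: "(\<Sum>i=1..N. real (\<eta> i) * real i) = real N"
    using \<eta> by (simp add: partitions_def mult.commute flip: of_nat_mult of_nat_sum)
  have lin: "(\<Sum>i=1..N. real (\<eta> i) * (c * real i + d)) = c * real N + d * ?n" for c d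
  proof -
    have "(\<Sum>i=1..N. real (\<eta> i) * (c * real i + d)) =
        c * (\<Sum>i=1..N. real (\<eta> i) * real i) + d * (\<Sum>i=1..N. real (\<eta> i))"
      unfolding sum_distrib_left sum.distrib[symmetric] by (simp add: algebra_simps)
    then show ?thesis
      by (simp only: n N)
  qed
  have "(\<Sum>i=1..N. real (\<eta> i) * (\<Sum>j=1..N. real (\<eta> j) * \<psi> i j)) =
      (\<Sum>i=1..N. real (\<eta> i) * ((a * ?n) * real i + (a * real N + b * ?n)))"
  proof (intro sum.cong refl)
    fix i assume "i \<in> {1..N}"
    then have "(\<Sum>j=1..N. real (\<eta> j) * \<psi> i j) = (\<Sum>j=1..N. real (\<eta> j) * (a * real j + (a * real i + b)))"
      by (intro sum.cong refl) (simp add: \<psi> algebra_simps)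
    then show "real (\<eta> i) * (\<Sum>j=1..N. real (\<eta> j) * \<psi> i j) =
        real (\<eta> i) * ((a * ?n) * real i + (a * real N + b * ?n))"
      by (simp only: lin) (simp add: algebra_simps)
  qed
  moreover have "(\<Sum>i=1..N. real (\<eta> i) * \<psi> i i) = (\<Sum>i=1..N. real (\<eta> i) * ((2 * a) * real i + b))"
    by (intro sum.cong refl) (simp add: \<psi> algebra_simps)
  moreover have "2 * total_coag_rate N \<psi> \<eta> =
    (\<Sum>i=1..N. real (\<eta> i) * (\<Sum>j=1..N. real (\<eta> j) * \<psi> i j)) - (\<Sum>i=1..N. real (\<eta> i) * \<psi> i i)"
    by (intro total_coag_rate_eq[OF \<eta>]) (simp add: \<psi> algebra_simps)
  ultimately show ?thesis
    by (simp only: lin) (simp add: algebra_simps)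
qed

text \<open>The weights \<open>k - 1\<close>, summed over all groups, give the total size minus the
  number of groups.\<close>

lemma total_frag_rate_linear:
  assumes \<eta>: "\<eta> \<in> partitions N"
    and v: "\<And>k. 1 \<le> k \<Longrightarrow> total_fragmentation \<phi> k = c * (real k - 1)"
  shows "total_frag_rate N \<phi> \<eta> = c * (real N - real (groups N \<eta>))"
proof -
  have "real (groups N \<eta>) = (\<Sum>i=1..N. real (\<eta> i))"
    by (simp add: groups_def)
  moreover have "real N = (\<Sum>i=1..N. real (\<eta> i) * real i)"
    using \<eta> by (simp add: partitions_def mult.commute flip: of_nat_mult of_nat_sum)
  moreover have "total_frag_rate N \<phi> \<eta> = (\<Sum>i=1..N. c * (real (\<eta> i) * real i - real (\<eta> i)))"
    unfolding total_frag_rate_eq by (intro sum.cong refl) (simp add: v algebra_simps)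
  ultimately show ?thesis
    by (simp only: sum_distrib_left[symmetric] sum_subtractf)
qed

section \<open>Necessity: test partitions with two and three groups\<close>

text \<open>The affine form comes from comparing partitions; the sign conditions come from
  nonnegativity of \<open>\<psi>\<close>, at arbitrarily large sizes for \<open>0 \<le> a\<close>
  and at the sizes \<open>1, 1\<close> for \<open>0 \<le> 2 * a + b\<close>.\<close>

lemma affine_coagulation:
  fixes \<psi> :: "nat \<Rightarrow> nat \<Rightarrow> real"
  assumes \<psi>: "\<And>i j. 1 \<le> i \<Longrightarrow> 1 \<le> j \<Longrightarrow> \<psi> i j = \<psi> j i \<and> 0 \<le> \<psi> i j"
    and const: "\<And>N \<eta> \<zeta>. \<lbrakk>\<eta> \<in> partitions N; \<zeta> \<in> partitions N; groups N \<eta> = groups N \<zeta>;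
      2 \<le> groups N \<eta>; groups N \<eta> \<le> N\<rbrakk> \<Longrightarrow> total_coag_rate N \<psi> \<eta> = total_coag_rate N \<psi> \<zeta>"
  shows "\<exists>a b. 0 \<le> a \<and> 0 \<le> 2 * a + b \<and> (\<forall>i\<ge>1. \<forall>j\<ge>1. \<psi> i j = a * (real i + real j) + b)"
proof -
  have sym: "\<psi> i j = \<psi> j i" if "1 \<le> i" "1 \<le> j" for i j
    using \<psi> that by blast
  have eq: "(\<Sum>x\<in>#A. \<Sum>y\<in>#A. \<psi> x y) - (\<Sum>x\<in>#A. \<psi> x x) =
      (\<Sum>x\<in>#B. \<Sum>y\<in>#B. \<psi> x y) - (\<Sum>x\<in>#B. \<psi> x x)"
    if "0 \<notin># A" "0 \<notin># B" "sum_mset A = sum_mset B" "size A = size B" "2 \<le> size A" for A B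
  proof -
    \<comment> \<open>Needed for the bound of the number of groups by the total size, a premise of
      \<open>const\<close>.\<close>
    have "1 \<le> sum_mset A"
      using that(1,5) count_partitions(3)[OF that(1)] by (cases A) auto
    then have "size A \<le> sum_mset A"
      using groups_partitions_bounds(2)[OF count_partitions(1)[OF that(1)]] count_partitions(2)[OF that(1)]
      by simp
    then have "total_coag_rate (sum_mset A) \<psi> (count A) = total_coag_rate (sum_mset B) \<psi> (count B)"
      using const[of "count A" "sum_mset A" "count B"] count_partitions(1,2)[OF that(1)]
        count_partitions(1,2)[OF that(2)] that by simp
    then show ?thesis
      using total_coag_rate_count[of A \<psi>, OF that(1) sym] total_coag_rate_count[of B \<psi>, OF that(2) sym] that(3) by simp
  qed
  have eq2: "\<psi> i j = \<psi> k l" if "1 \<le> i" "1 \<le> j" "1 \<le> k" "1 \<le> l" "i + j = k + l" for i j k l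
  proof -
    have "\<psi> i j + \<psi> j i = \<psi> k l + \<psi> l k"
      using eq[of "{#i, j#}" "{#k, l#}"] that by simp
    then show ?thesis
      using sym[of i j] sym[of k l] that by linarith
  qed
  have eq3: "\<psi> i j + \<psi> i k + \<psi> j k = \<psi> l m + \<psi> l n + \<psi> m n"
    if "1 \<le> i" "1 \<le> j" "1 \<le> k" "1 \<le> l" "1 \<le> m" "1 \<le> n" "i + j + k = l + m + n" for i j k l m n
  proof -
    have "(\<psi> i j + \<psi> j i) + (\<psi> i k + \<psi> k i) + (\<psi> j k + \<psi> k j) =
        (\<psi> l m + \<psi> m l) + (\<psi> l n + \<psi> n l) + (\<psi> m n + \<psi> n m)"
      using eq[of "{#i, j, k#}" "{#l, m, n#}"] that by simp
    then show ?thesis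
      using sym[of i j] sym[of i k] sym[of j k] sym[of l m] sym[of l n] sym[of m n] that by linarith
  qed
  \<comment> \<open>\<open>g m\<close> is the common value of \<open>\<psi>\<close> on pairs of
    total size \<open>m\<close>; only \<open>m \<ge> 2\<close> is meaningful.\<close>
  define g where "g m = \<psi> 1 (m - 1)" for m
  have g: "\<psi> i j = g k" if "1 \<le> i" "1 \<le> j" "i + j = k" for i j k
    unfolding g_def using that by (intro eq2) auto
  have step: "g (m + 1) = g m + (g 3 - g 2)" if "2 \<le> m" for m
  proof (cases "m = 2")
    case False
    with that have "3 \<le> m" by simp
    \<comment> \<open>The groups \<open>1, 1, m\<close> against \<open>1, 2, m - 1\<close>: the pair
      sums are \<open>2, m + 1, m + 1\<close> and \<open>3, m, m + 1\<close>, so one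
      \<open>g (m + 1)\<close> cancels.\<close>
    then have "\<psi> 1 1 + \<psi> 1 m + \<psi> 1 m = \<psi> 1 2 + \<psi> 1 (m - 1) + \<psi> 2 (m - 1)"
      by (intro eq3) auto
    moreover have "\<psi> 1 1 = g 2" "\<psi> 1 2 = g 3" "\<psi> 1 m = g (m + 1)"
      "\<psi> 1 (m - 1) = g m" "\<psi> 2 (m - 1) = g (m + 1)"
      using \<open>3 \<le> m\<close> by (auto intro: g)
    ultimately have "g 2 + g (m + 1) + g (m + 1) = g 3 + g m + g (m + 1)"
      by (simp only:)
    then show ?thesis
      by linarith
  qed simp
  have lin: "g (m + 2) = g 2 + real m * (g 3 - g 2)" for m
  proof (induction m)
    case (Suc m)
    then show ?case
      using step[of "m + 2"] by (simp add: algebra_simps)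
  qed (simp add: numeral_2_eq_2)
  have g_nonneg: "0 \<le> g (m + 2)" for m
    using \<psi>[of 1 "m + 1"] by (simp add: g_def)
  \<comment> \<open>A negative slope would make \<open>g\<close> negative at large arguments, by the
    Archimedean property.\<close>
  have slope: "0 \<le> g 3 - g 2"
  proof (rule ccontr)
    assume "\<not> 0 \<le> g 3 - g 2"
    then obtain m where "g 2 < real m * (g 2 - g 3)"
      using ex_less_of_nat_mult[of "g 2 - g 3" "g 2"] by auto
    then show False
      using g_nonneg[of m] lin[of m] by (simp add: algebra_simps)
  qed
  \<comment> \<open>With these choices of \<open>a\<close> and \<open>b\<close> the value
    \<open>2 * a + b\<close> is \<open>g 2\<close>, that is \<open>\<psi> 1 1\<close>.\<close>
  have "\<psi> i j = (g 3 - g 2) * (real i + real j) + (g 2 - 2 * (g 3 - g 2))" if "1 \<le> i" "1 \<le> j" for i j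
  proof -
    have "\<psi> i j = g (i + j - 2 + 2)"
      using that by (intro g) auto
    also have "\<dots> = g 2 + (real i + real j - 2) * (g 3 - g 2)"
      using that by (simp only: lin) (simp add: of_nat_diff)
    finally show ?thesis
      by (simp add: algebra_simps)
  qed
  moreover have "0 \<le> g 2"
    using g_nonneg[of 0] by (simp add: numeral_2_eq_2)
  ultimately show ?thesis
    using slope by (intro exI[of _ "g 3 - g 2"] exI[of _ "g 2 - 2 * (g 3 - g 2)"]) auto
qed

text \<open>Two groups suffice here, because the total fragmentation rate is additive over groups. A
  group of size one cannot split, so \<open>v_1 = 0\<close>, and the common difference of the
  progression is \<open>v_2\<close>.\<close>

lemma linear_fragmentation:
  assumes const: "\<And>N \<eta> \<zeta>. \<lbrakk>\<eta> \<in> partitions N; \<zeta> \<in> partitions N; groups N \<eta> = groups N \<zeta>;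
      1 \<le> groups N \<eta>; groups N \<eta> + 1 \<le> N\<rbrakk> \<Longrightarrow> total_frag_rate N \<phi> \<eta> = total_frag_rate N \<phi> \<zeta>"
    and "1 \<le> k"
  shows "total_fragmentation \<phi> k = \<phi> 1 1 * (real k - 1)"
proof -
  have "{(i, j). 1 \<le> i \<and> i \<le> j \<and> i + j = (1::nat)} = {}"
    by auto
  then have v1: "total_fragmentation \<phi> 1 = 0"
    unfolding total_fragmentation_def by (simp only: sum.empty)
  have "{(i, j). 1 \<le> i \<and> i \<le> j \<and> i + j = (2::nat)} = {(1, 1)}"
    by auto
  then have v2: "total_fragmentation \<phi> 2 = \<phi> 1 1"
    unfolding total_fragmentation_def by (simp only:) simp
  have increment: "total_fragmentation \<phi> (n + 1) = total_fragmentation \<phi> n + \<phi> 1 1" if "1 \<le> n" for n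
  proof -
    \<comment> \<open>Both have two groups and total size \<open>n + 2\<close>. As
      \<open>n \<ge> 1\<close>, this exceeds two, as required by the range of the birth
      rates.\<close>
    let ?A = "{#1, n + 1#}" and ?B = "{#2, n#}"
    have "0 \<notin># ?A" "0 \<notin># ?B" and sum: "sum_mset ?B = sum_mset ?A"
      using that by auto
    note A = count_partitions(1,2)[OF this(1)] and B = count_partitions(1,2)[OF this(2)]
      and vals = total_frag_rate_count[OF this(1)] total_frag_rate_count[OF this(2)]
    have "total_frag_rate (sum_mset ?A) \<phi> (count ?A) = total_frag_rate (sum_mset ?B) \<phi> (count ?B)"
      unfolding sum
    proof (rule const)
      show "count ?B \<in> partitions (sum_mset ?A)" "groups (sum_mset ?A) (count ?A) = groups (sum_mset ?A) (count ?B)"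
        using A B unfolding sum by auto
      show "1 \<le> groups (sum_mset ?A) (count ?A)" "groups (sum_mset ?A) (count ?A) + 1 \<le> sum_mset ?A"
        using A(2) that by simp_all
    qed (rule A(1))
    then show ?thesis
      unfolding vals using v1 v2 by simp
  qed
  show ?thesis
    using \<open>1 \<le> k\<close>
  proof (induction k rule: dec_induct)
    case base
    then show ?case
      using v1 by simp
  next
    case (step n)
    then show ?case
      using increment[of n] by (simp add: algebra_simps)
  qed
qed

text \<open>The quantifier over all \<open>N\<close> matters for necessity: the test partitions that
  determine the rates at size \<open>m\<close> have total size \<open>m + 2\<close>.\<close>

theorem proposition1:
  fixes \<psi> \<phi> :: "nat \<Rightarrow> nat \<Rightarrow> real"
    and M :: "nat \<Rightarrow> state pmf \<Rightarrow> 'w measure"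
    and X :: "nat \<Rightarrow> state pmf \<Rightarrow> real \<Rightarrow> 'w \<Rightarrow> state"
  assumes "\<And>i j. 1 \<le> i \<Longrightarrow> 1 \<le> j \<Longrightarrow> \<psi> i j = \<psi> j i \<and> 0 \<le> \<psi> i j"
    and "\<And>i j. 1 \<le> i \<Longrightarrow> 1 \<le> j \<Longrightarrow> \<phi> i j = \<phi> j i \<and> 0 \<le> \<phi> i j"
    and "\<And>N. 1 \<le> N \<Longrightarrow> is_CFP N \<psi> \<phi> (M N) (X N)"
    and "\<And>N. 1 \<le> N \<Longrightarrow> ergodic N (M N) (X N)"
  shows "(\<forall>N\<ge>1. time_homogeneous_birth_death N (M N) (\<lambda>\<rho> t \<omega>. groups N (X N \<rho> t \<omega>)))
     \<longleftrightarrow>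
     (\<exists>a b::real. 0 \<le> a \<and> 0 \<le> 2 * a + b \<and>
        (\<forall>i\<ge>1. \<forall>j\<ge>1. \<psi> i j = a * (real i + real j) + b)) \<and>
     (\<forall>k\<ge>1. total_fragmentation \<phi> k = \<phi> 1 1 * (real k - 1))"
    (is "?L \<longleftrightarrow> ?A \<and> ?V")
proof -
  \<comment> \<open>Two premises \<open>1 \<le> N\<close> remain, one from the hypothesis on the
    process and one from the lemma; hence \<open>OF N N\<close> below.\<close>
  note iff = time_homogeneous_birth_death_groups_iff[OF assms(3)]
  show ?thesis
  proof (intro iffI conjI)
    assume L: ?L
    show ?A
    proof (rule affine_coagulation[OF assms(1)])
      fix N \<eta> \<zeta>
      assume *: "\<eta> \<in> partitions N" "\<zeta> \<in> partitions N" "groups N \<eta> = groups N \<zeta>"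
        "2 \<le> groups N \<eta>" "groups N \<eta> \<le> N"
      then have N: "1 \<le> N" by simp
      with L iff[OF N N] * show "total_coag_rate N \<psi> \<eta> = total_coag_rate N \<psi> \<zeta>"
        by metis
    qed
    show ?V
    proof (intro allI impI)
      fix k :: nat assume "1 \<le> k"
      show "total_fragmentation \<phi> k = \<phi> 1 1 * (real k - 1)"
      proof (rule linear_fragmentation[OF _ \<open>1 \<le> k\<close>])
        fix N \<eta> \<zeta>
        assume *: "\<eta> \<in> partitions N" "\<zeta> \<in> partitions N" "groups N \<eta> = groups N \<zeta>"
          "1 \<le> groups N \<eta>" "groups N \<eta> + 1 \<le> N"
        then have N: "1 \<le> N" by simp
        with L iff[OF N N] * show "total_frag_rate N \<phi> \<eta> = total_frag_rate N \<phi> \<zeta>"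
          by metis
      qed
    qed
  next
    assume AV: "?A \<and> ?V"
    then obtain a b where \<psi>: "\<And>i j. 1 \<le> i \<Longrightarrow> 1 \<le> j \<Longrightarrow> \<psi> i j = a * (real i + real j) + b"
      by blast
    show ?L
    proof (intro allI impI)
      fix N :: nat assume N: "1 \<le> N"
      \<comment> \<open>This value and the next depend on \<open>\<eta>\<close> only through
        \<open>r\<close>, so they serve as the constants \<open>l\<close> of the criterion.\<close>
      have "total_coag_rate N \<psi> \<eta> =
          (real r - 1) * (2 * a * real N + b * real r) / 2" if "\<eta> \<in> partitions N" "groups N \<eta> = r" for \<eta> r
        using total_coag_rate_affine[OF that(1) \<psi>] that(2) by simp
      moreover have "total_frag_rate N \<phi> \<eta> = \<phi> 1 1 * (real N - real r)"
        if "\<eta> \<in> partitions N" "groups N \<eta> = r" for \<eta> r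
        using total_frag_rate_linear[OF that(1), of \<phi> "\<phi> 1 1"] AV that(2) by simp
      ultimately show "time_homogeneous_birth_death N (M N) (\<lambda>\<rho> t \<omega>. groups N (X N \<rho> t \<omega>))"
        unfolding iff[OF N N] by blast
    qed
  qed
qed

end
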